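(* For the relay Markov decision process $\{(Y_n,A_n),n\ge0\}$ described in the context, the optimal policy (minimizing the long-run average cost $V(u)=\lim_{N\to\infty}\frac{1}{N+1}E_u[\sum_{n=0}^N C(Y_n,A_n)\mid Y_0=(0,0)]$) is of threshold type: there exist nonnegative integers $L_1^*,L_2^*$ such that the optimal deterministic action in state $(i,0)$ is to wait ($A_n=0$) if $i\le L_1^*$ and to transmit without coding ($A_n=1$) if $i>L_1^*$, while in state $(0,j)$ it is to wait if $j\le L_2^*$ and to transmit without coding if $j>L_2^*$.
   Context: A relay node keeps two queues $q_1,q_2$. Time is slotted; in each slot a packet arrives to $q_i$ with probability $p_i\in(0,1)$ ($i=1,2$), independently across queues and slots, at most one per queue per slot. $Y_n=(Y_n^1,Y_n^2)$ is the number of packets in $(q_1,q_2)$ at the end of slot $n$ just before the transmission opportunity, and $A_n\in\{0,1\}$ is the action ($0$ = do nothing, $1$ = transmit). If $Y^1_n+Y^2_n=0$ then $A_n=0$; if $Y^1_nY^2_n>0$ then $A_n=1$ (XOR-coded transmission of one packet from each queue). The state space is $\{(i,j)\in\mathbb{Z}_{\ge0}^2:\min(i,j)\le1\}$. With $\hat p_1=(1-p_1)(1-p_2)$, $\hat p_2=p_1(1-p_2)$, $\hat p_3=(1-p_1)p_2$, $\hat p_4=p_1p_2$, $[x]^+=\max(x,0)$: $P_1((i,j),([i-1]^+,[j-1]^+))=\hat p_1$, $P_1((i,j),(\max(i,1),[j-1]^+))=\hat p_2$, $P_1((i,j),([i-1]^+,\max(j,1)))=\hat p_3$, $P_1((i,j),(\max(i,1),\max(j,1)))=\hat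 p_4$, $P_0((i,j),(i,j))=\hat p_1$, $P_0((i,j),(i+1,j))=\hat p_2$, $P_0((i,j),(i,j+1))=\hat p_3$, $P_0((i,j),(i+1,j+1))=\hat p_4$. One-step cost: $C(Y_n,A_n)=C_h([Y^1_n-A_n]^+ + [Y^2_n-A_n]^+)+C_tA_n$, where $C_t>0$ is the transmission cost and $C_h>0$ the per-slot holding cost. *)

theory Defs
  imports "HOL-Probability.Probability"
begin

type_synonym state = "nat \<times> nat"
type_synonym hist = "(state \<times> bool) list"

text \<open>Action True = transmit (A_n = 1), False = do nothing (A_n = 0).
  A (general: history-dependent, randomized) policy maps the past history of
  (state, action) pairs and the current state to a distribution over actions.\<close>
type_synonym policy = "hist \<Rightarrow> state \<Rightarrow> bool pmf"

definition trans :: "real \<Rightarrow> real \<Rightarrow> state \<Rightarrow> bool \<Rightarrow> state pmf" where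
  "trans p1 p2 s a = do {
     x \<leftarrow> bernoulli_pmf p1;
     y \<leftarrow> bernoulli_pmf p2;
     return_pmf (if a then (if x then max (fst s) 1 else fst s - 1,
                            if y then max (snd s) 1 else snd s - 1)
                 else (fst s + (if x then 1 else 0), snd s + (if y then 1 else 0))) }"

text \<open>One-step cost C(y,a) = C_h([y1-a]^+ + [y2-a]^+) + C_t a (nat subtraction is [.]^+).\<close>
definition cost :: "real \<Rightarrow> real \<Rightarrow> state \<Rightarrow> bool \<Rightarrow> real" where
  "cost Ch Ct s a = Ch * real ((fst s - of_bool a) + (snd s - of_bool a)) + Ct * of_bool a"

definition admissible :: "policy \<Rightarrow> bool" where
  "admissible \<pi> \<longleftrightarrow> (\<forall>h i j.
      (i + j = 0 \<longrightarrow> \<pi> h (i, j) = return_pmf False) \<and>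
      (0 < i * j \<longrightarrow> \<pi> h (i, j) = return_pmf True))"

fun traj :: "real \<Rightarrow> real \<Rightarrow> policy \<Rightarrow> nat \<Rightarrow> (hist \<times> state) pmf" where
  "traj p1 p2 \<pi> 0 = return_pmf ([], (0, 0))"
| "traj p1 p2 \<pi> (Suc n) = do {
     (h, s) \<leftarrow> traj p1 p2 \<pi> n;
     a \<leftarrow> \<pi> h s;
     s' \<leftarrow> trans p1 p2 s a;
     return_pmf (h @ [(s, a)], s') }"

definition exp_cost :: "real \<Rightarrow> real \<Rightarrow> real \<Rightarrow> real \<Rightarrow> policy \<Rightarrow> nat \<Rightarrow> real" where
  "exp_cost p1 p2 Ch Ct \<pi> n = measure_pmf.expectation
     (do { (h, s) \<leftarrow> traj p1 p2 \<pi> n; a \<leftarrow> \<pi> h s; return_pmf (s, a) })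
     (\<lambda>(s, a). cost Ch Ct s a)"

definition avg_cost :: "real \<Rightarrow> real \<Rightarrow> real \<Rightarrow> real \<Rightarrow> policy \<Rightarrow> ereal" where
  "avg_cost p1 p2 Ch Ct \<pi> =
     limsup (\<lambda>N. ereal ((\<Sum>n\<le>N. exp_cost p1 p2 Ch Ct \<pi> n) / real (N + 1)))"

definition thr_action :: "nat \<Rightarrow> nat \<Rightarrow> state \<Rightarrow> bool" where
  "thr_action L1 L2 s =
     (if fst s + snd s = 0 then False
      else if 0 < fst s * snd s then True
      else if snd s = 0 then L1 < fst s
      else L2 < snd s)"

definition thr_policy :: "nat \<Rightarrow> nat \<Rightarrow> policy" where
  "thr_policy L1 L2 h s = return_pmf (thr_action L1 L2 s)"

end

theory Submission
  imports Defs
begin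

text \<open>
  Right after a decision at most one queue is nonempty, so the post-decision state is an integer
  \<open>z\<close>, its sign telling which queue is occupied. Writing \<open>w\<close> for the relative value and
  \<open>D z = w z - w (z - 1)\<close>, \<open>z \<ge> 1\<close>, for its slope on the first axis, truncated at \<open>Ct\<close>, the average
  cost optimality equation with gain \<open>g\<close> becomes the backward recursion
  \<open>D z = min Ct ((Ch z + p2 Ct + p1 (1 - p2) D (z + 1) - g) / ((1 - p1) p2))\<close>,
  with \<open>D z = Ct\<close> for large \<open>z\<close>, and symmetrically on the other axis. The two axes are coupled only
  by the equation at \<open>z = 0\<close>, which determines \<open>g\<close> by the intermediate value theorem. The truncation is
  active exactly where \<open>g \<le> Ch z + p1 Ct\<close>, and transmitting is optimal there, which yields the
  threshold.

  Truncating turns the quadratically growing solution of the optimality equation into a subsolution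
  of linear growth that agrees with it on the states visited by the threshold policy. Linear growth
  matches the growth of the holding cost, so the lower bound \<open>g\<close> holds for every policy,
  with no moment condition on its trajectories.
\<close>

section \<open>Slopes of the relative value function\<close>

text \<open>The recursion runs backward from a cutoff \<open>M\<close>, so the index
  \<open>k\<close> stands for the position \<open>M - k\<close> on the axis.\<close>

primrec gap_down :: "real \<Rightarrow> real \<Rightarrow> real \<Rightarrow> real \<Rightarrow> nat \<Rightarrow> real \<Rightarrow> nat \<Rightarrow> real" where
  "gap_down p q Ch Ct M g 0 = Ct"
| "gap_down p q Ch Ct M g (Suc k) =
     min Ct ((Ch * real (M - Suc k) + q * Ct + p * (1 - q) * gap_down p q Ch Ct M g k - g)
             / ((1 - p) * q))"

text \<open>From the position \<open>Ct / Ch\<close> on, one slot of holding costs at least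
  \<open>Ct\<close>, so the truncation is active for every \<open>g \<le> Ct\<close>. The cutoff
  does not depend on \<open>g\<close>, which makes each slope a finite composition of continuous
  functions of \<open>g\<close>.\<close>

definition gap :: "real \<Rightarrow> real \<Rightarrow> real \<Rightarrow> real \<Rightarrow> real \<Rightarrow> nat \<Rightarrow> real" where
  "gap p q Ch Ct g z = gap_down p q Ch Ct (nat \<lceil>Ct / Ch\<rceil>) g (nat \<lceil>Ct / Ch\<rceil> - z)"

lemma gap_le: "gap p q Ch Ct g z \<le> Ct"
  unfolding gap_def by (cases "nat \<lceil>Ct / Ch\<rceil> - z") auto

lemma gap_far: "nat \<lceil>Ct / Ch\<rceil> \<le> z \<Longrightarrow> gap p q Ch Ct g z = Ct"
  by (simp add: gap_def)

lemma gap_near: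
  assumes "z < nat \<lceil>Ct / Ch\<rceil>"
  shows "gap p q Ch Ct g z =
    min Ct ((Ch * real z + q * Ct + p * (1 - q) * gap p q Ch Ct g (Suc z) - g) / ((1 - p) * q))"
proof -
  define M where "M = nat \<lceil>Ct / Ch\<rceil>"
  have "M - z = Suc (M - Suc z)" "M - Suc (M - Suc z) = z"
    using assms by (auto simp: M_def)
  then show ?thesis
    unfolding gap_def M_def[symmetric] by simp
qed

lemma continuous_on_gap:
  assumes "0 < p" "p < 1" "0 < q"
  shows "continuous_on S (\<lambda>g. gap p q Ch Ct g z)"
proof -
  have "continuous_on S (\<lambda>g. gap_down p q Ch Ct M g k)" for M k
    using assms by (induction k) (auto intro!: continuous_intros)
  then show ?thesis
    unfolding gap_def .
qed

lemma gap_induct [consumes 0, case_names far near]: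
  fixes z M :: nat
  assumes "\<And>z. M \<le> z \<Longrightarrow> P z" and "\<And>z. z < M \<Longrightarrow> P (Suc z) \<Longrightarrow> P z"
  shows "P z"
proof (induction "M - z" arbitrary: z)
  case 0
  then show ?case by (simp add: assms(1))
next
  case (Suc k)
  then have "k = M - Suc z" "z < M" by auto
  then show ?case using Suc.hyps(1) assms(2) by blast
qed

section \<open>Where the truncation of the slopes is active\<close>

context
  fixes p q Ch Ct :: real
  assumes p: "0 < p" "p < 1" and q: "0 < q" "q < 1" and Ct: "0 < Ct" and Ch: "0 < Ch"
begin

lemma holding_cost_far:
  assumes "nat \<lceil>Ct / Ch\<rceil> \<le> z" shows "Ct \<le> Ch * real z"
proof -
  have "Ct / Ch \<le> real z"
    using real_nat_ceiling_ge[of "Ct / Ch"] assms by (meson of_nat_le_iff order_trans)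
  then show ?thesis using Ch by (simp add: field_simps)
qed

text \<open>The value \<open>Ct\<close> is self-reproducing because
  \<open>q Ct + p (1 - q) Ct - (1 - p) q Ct = p Ct\<close>.\<close>

lemma gap_rec:
  assumes "g \<le> Ct"
  shows "gap p q Ch Ct g z =
    min Ct ((Ch * real z + q * Ct + p * (1 - q) * gap p q Ch Ct g (Suc z) - g) / ((1 - p) * q))"
proof (cases "z < nat \<lceil>Ct / Ch\<rceil>")
  case True
  then show ?thesis by (rule gap_near)
next
  case False
  then have "Ct \<le> Ch * real z" using holding_cost_far[of z] not_less by blast
  moreover have "0 < p * Ct" using p Ct by simp
  ultimately have "Ct * ((1 - p) * q) \<le> Ch * real z + q * Ct + p * (1 - q) * Ct - g"
    using assms by (simp add: algebra_simps)
  then have "Ct \<le> (Ch * real z + q * Ct + p * (1 - q) * Ct - g) / ((1 - p) * q)"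
    using p q by (simp add: pos_le_divide_eq)
  moreover have "gap p q Ch Ct g z = Ct" "gap p q Ch Ct g (Suc z) = Ct"
    using False by (auto intro!: gap_far simp del: nat_ceiling_le_eq)
  ultimately show ?thesis by simp
qed

lemma gap_subsolution:
  assumes "g \<le> Ct"
  shows "g \<le> Ch * real z + q * Ct + p * (1 - q) * gap p q Ch Ct g (Suc z)
             - (1 - p) * q * gap p q Ch Ct g z"
proof -
  have "gap p q Ch Ct g z \<le>
    (Ch * real z + q * Ct + p * (1 - q) * gap p q Ch Ct g (Suc z) - g) / ((1 - p) * q)"
    by (subst gap_rec[OF assms]) simp
  then show ?thesis using p q by (simp add: pos_le_divide_eq algebra_simps)
qed

text \<open>Even the largest possible successor slope \<open>Ct\<close> keeps the second argument of
  \<open>min\<close> at or below \<open>Ct\<close>, so the recursion holds untruncated.\<close>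

lemma gap_solution:
  assumes "g \<le> Ct" "Ch * real z + p * Ct \<le> g"
  shows "g = Ch * real z + q * Ct + p * (1 - q) * gap p q Ch Ct g (Suc z)
             - (1 - p) * q * gap p q Ch Ct g z"
proof -
  have "p * (1 - q) * gap p q Ch Ct g (Suc z) \<le> p * (1 - q) * Ct"
    using p q gap_le by (intro mult_left_mono) auto
  then have "Ch * real z + q * Ct + p * (1 - q) * gap p q Ch Ct g (Suc z) - g \<le> Ct * ((1 - p) * q)"
    using assms(2) by (simp add: algebra_simps)
  then have "(Ch * real z + q * Ct + p * (1 - q) * gap p q Ch Ct g (Suc z) - g) / ((1 - p) * q) \<le> Ct"
    using p q by (simp add: pos_divide_le_eq)
  then have "gap p q Ch Ct g z =
    (Ch * real z + q * Ct + p * (1 - q) * gap p q Ch Ct g (Suc z) - g) / ((1 - p) * q)"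
    by (subst gap_rec[OF assms(1)]) simp
  then show ?thesis using p q by (simp add: field_simps)
qed

text \<open>The assumed bound on \<open>g\<close> passes from \<open>z\<close> to
  \<open>Suc z\<close>, so backward induction supplies the slope \<open>Ct\<close> at the successor,
  and \<open>Ct\<close> then reproduces itself at \<open>z\<close>.\<close>

lemma gap_eq_Ct:
  assumes "g \<le> Ct" "g \<le> Ch * real z + p * Ct"
  shows "gap p q Ch Ct g z = Ct"
  using assms(2)
proof (induction z rule: gap_induct[where M = "nat \<lceil>Ct / Ch\<rceil>"])
  case (far z)
  then show ?case by (simp add: gap_far)
next
  case (near z)
  have "Ch * real z \<le> Ch * real (Suc z)" using Ch by (intro mult_left_mono) auto
  then have *: "gap p q Ch Ct g (Suc z) = Ct" using near by linarith
  have "Ct * ((1 - p) * q) \<le> Ch * real z + q * Ct + p * (1 - q) * Ct - g"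
    using near by (simp add: algebra_simps)
  then have "Ct \<le> (Ch * real z + q * Ct + p * (1 - q) * Ct - g) / ((1 - p) * q)"
    using p q by (simp add: pos_le_divide_eq)
  then show ?case by (subst gap_rec[OF assms(1)]) (simp add: *)
qed

lemma gap_nonneg:
  assumes "g \<le> Ct" "g \<le> q * Ct"
  shows "0 \<le> gap p q Ch Ct g z"
proof (induction z rule: gap_induct[where M = "nat \<lceil>Ct / Ch\<rceil>"])
  case (far z)
  then show ?case using Ct by (simp add: gap_far)
next
  case (near z)
  have "0 \<le> p * (1 - q) * gap p q Ch Ct g (Suc z)" using near p q by simp
  moreover have "0 \<le> Ch * real z" using Ch by simp
  ultimately have "0 \<le> Ch * real z + q * Ct + p * (1 - q) * gap p q Ch Ct g (Suc z) - g"
    using assms(2) by linarith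
  then have "0 \<le> (Ch * real z + q * Ct + p * (1 - q) * gap p q Ch Ct g (Suc z) - g) / ((1 - p) * q)"
    using p q by simp
  then show ?case using Ct by (subst gap_rec[OF assms(1)]) simp
qed

lemma gap_threshold:
  assumes "p * Ct \<le> g" "g \<le> Ct"
  obtains L where
    "\<And>z. z \<le> L \<Longrightarrow> g = Ch * real z + q * Ct + p * (1 - q) * gap p q Ch Ct g (Suc z)
                        - (1 - p) * q * gap p q Ch Ct g z"
    "\<And>z. L < z \<Longrightarrow> gap p q Ch Ct g z = Ct"
proof -
  define t where "t = (g - p * Ct) / Ch"
  have t: "0 \<le> t" "g = Ch * t + p * Ct" using assms Ch by (auto simp: t_def)
  show thesis
  \<comment> \<open>The witness is the largest \<open>z\<close> with
    \<open>Ch * z + p * Ct \<le> g\<close>. It exists because \<open>p * Ct \<le> g\<close>.\<close>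
  proof (rule that[of "nat \<lfloor>t\<rfloor>"])
    fix z assume "z \<le> nat \<lfloor>t\<rfloor>"
    then have "real z \<le> t" using t by linarith
    then have "Ch * real z \<le> Ch * t" using Ch by simp
    then show "g = Ch * real z + q * Ct + p * (1 - q) * gap p q Ch Ct g (Suc z)
                 - (1 - p) * q * gap p q Ch Ct g z"
      using t assms by (intro gap_solution) auto
  next
    fix z assume "nat \<lfloor>t\<rfloor> < z"
    then have "t \<le> real z" using t by linarith
    then have "Ch * t \<le> Ch * real z" using Ch by simp
    then show "gap p q Ch Ct g z = Ct"
      using t assms by (intro gap_eq_Ct) auto
  qed
qed

end

section \<open>Existence of the gain\<close>

lemma optimal_gain_exists:
  fixes p1 p2 Ch Ct :: real
  assumes p1: "0 < p1" "p1 < 1" and p2: "0 < p2" "p2 < 1" and Ct: "0 < Ct" and Ch: "0 < Ch"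
  obtains g where "p1 * Ct \<le> g" "p2 * Ct \<le> g" "g \<le> Ct"
    "g = p1 * p2 * Ct + p1 * (1 - p2) * gap p1 p2 Ch Ct g 1 + (1 - p1) * p2 * gap p2 p1 Ch Ct g 1"
proof -
  \<comment> \<open>\<open>\<Phi>\<close> is the residual of the optimality equation at the empty
    state. The endpoint \<open>a\<close> is the least gain for which both axes have a threshold;
    \<open>b\<close> is the value of the right-hand side when both slopes equal
    \<open>Ct\<close>.\<close>
  define \<Phi> where "\<Phi> = (\<lambda>g. p1 * p2 * Ct + p1 * (1 - p2) * gap p1 p2 Ch Ct g 1
      + (1 - p1) * p2 * gap p2 p1 Ch Ct g 1 - g)"
  define a where "a = max p1 p2 * Ct"
  define b where "b = (p1 + p2 - p1 * p2) * Ct"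
  have "(1 - p1) * (1 - p2) > 0" using p1 p2 by simp
  then have sum_le: "p1 + p2 - p1 * p2 \<le> 1" by (simp add: algebra_simps)
  have b_le: "b \<le> Ct" using sum_le Ct by (simp add: b_def)
  have "p1 * p2 \<le> p1" "p1 * p2 \<le> p2" using p1 p2 by (auto simp: mult_le_cancel_left1 mult_le_cancel_right1)
  then have ab: "a \<le> b" unfolding a_def b_def using Ct by (intro mult_right_mono) auto
  \<comment> \<open>On the axis of the queue with the larger arrival probability the slope at 1 is
    already \<open>Ct\<close>. Its terms add up to exactly \<open>a\<close>, leaving a multiple of
    the other slope, which is nonnegative.\<close>
  have "0 \<le> \<Phi> a"
  proof (cases "p1 \<le> p2")
    case True
    then have a: "a = p2 * Ct" by (simp add: a_def)
    have "gap p2 p1 Ch Ct a 1 = Ct"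
      using assms a ab b_le by (intro gap_eq_Ct) auto
    moreover have "0 \<le> gap p1 p2 Ch Ct a 1"
      using assms a ab b_le by (intro gap_nonneg) auto
    then have "0 \<le> p1 * (1 - p2) * gap p1 p2 Ch Ct a 1" using p1 p2 by simp
    ultimately show ?thesis by (simp add: \<Phi>_def a algebra_simps)
  next
    case False
    then have a: "a = p1 * Ct" by (simp add: a_def)
    have "gap p1 p2 Ch Ct a 1 = Ct"
      using assms a ab b_le by (intro gap_eq_Ct) auto
    moreover have "0 \<le> gap p2 p1 Ch Ct a 1"
      using assms a ab b_le by (intro gap_nonneg) auto
    then have "0 \<le> (1 - p1) * p2 * gap p2 p1 Ch Ct a 1" using p1 p2 by simp
    ultimately show ?thesis by (simp add: \<Phi>_def a algebra_simps)
  qed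
  moreover have "\<Phi> b \<le> 0"
  proof -
    have "p1 * (1 - p2) * gap p1 p2 Ch Ct b 1 \<le> p1 * (1 - p2) * Ct"
      "(1 - p1) * p2 * gap p2 p1 Ch Ct b 1 \<le> (1 - p1) * p2 * Ct"
      using p1 p2 by (intro mult_left_mono gap_le; simp)+
    then show ?thesis by (simp add: \<Phi>_def b_def algebra_simps)
  qed
  moreover have "continuous_on {a..b} \<Phi>"
    unfolding \<Phi>_def using p1 p2 by (intro continuous_intros continuous_on_gap) auto
  ultimately obtain g where g: "a \<le> g" "g \<le> b" "\<Phi> g = 0"
    using IVT2'[of \<Phi> b 0 a] ab by auto
  have "p1 * Ct \<le> a" "p2 * Ct \<le> a" unfolding a_def using Ct by (auto intro: mult_right_mono)
  with g b_le show thesis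
    by (intro that[of g]) (auto simp: \<Phi>_def)
qed

section \<open>Expectations along trajectories\<close>

lemma expectation_bind_finite:
  fixes f :: "'b \<Rightarrow> real"
  assumes "finite (set_pmf p)" "\<And>x. x \<in> set_pmf p \<Longrightarrow> finite (set_pmf (k x))"
  shows "measure_pmf.expectation (bind_pmf p k) f =
    measure_pmf.expectation p (\<lambda>x. measure_pmf.expectation (k x) f)"
proof -
  have "measure_pmf.expectation (bind_pmf p k) f =
      (\<Sum>x\<in>set_pmf p. pmf p x *\<^sub>R measure_pmf.expectation (k x) f)"
    using assms by (intro pmf_expectation_bind) auto
  also have "\<dots> = measure_pmf.expectation p (\<lambda>x. measure_pmf.expectation (k x) f)"
    using assms by (intro integral_measure_pmf[symmetric]) auto
  finally show ?thesis .
qed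

lemma finite_set_trans: "finite (set_pmf (trans p1 p2 s a))"
  by (auto simp: trans_def)

text \<open>With binary actions and arrivals every trajectory law has finite support, so all
  expectations are finite sums and integrability is automatic.\<close>

lemma finite_set_traj: "finite (set_pmf (traj p1 p2 \<pi> n))"
  by (induction n) (auto simp: finite_set_trans split: prod.splits)

lemma expectation_mono_finite:
  fixes f f' :: "'a \<Rightarrow> real"
  assumes "finite (set_pmf p)" "\<And>x. x \<in> set_pmf p \<Longrightarrow> f x \<le> f' x"
  shows "measure_pmf.expectation p f \<le> measure_pmf.expectation p f'"
  using assms by (intro integral_mono_AE integrable_measure_pmf_finite) (auto simp: AE_measure_pmf_iff)

lemma expectation_cong_pmf:
  fixes f f' :: "'a \<Rightarrow> real"
  assumes "\<And>x. x \<in> set_pmf p \<Longrightarrow> f x = f' x"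
  shows "measure_pmf.expectation p f = measure_pmf.expectation p f'"
  using assms by (intro integral_cong_AE) (auto simp: AE_measure_pmf_iff)

definition exp_state :: "real \<Rightarrow> real \<Rightarrow> policy \<Rightarrow> (state \<Rightarrow> real) \<Rightarrow> nat \<Rightarrow> real" where
  "exp_state p1 p2 \<pi> f n = measure_pmf.expectation (traj p1 p2 \<pi> n) (\<lambda>(h, s). f s)"

lemma exp_state_0: "exp_state p1 p2 \<pi> f 0 = f (0, 0)"
  by (simp add: exp_state_def)

lemma exp_cost_alt:
  "exp_cost p1 p2 Ch Ct \<pi> n = measure_pmf.expectation (traj p1 p2 \<pi> n)
     (\<lambda>(h, s). measure_pmf.expectation (\<pi> h s) (cost Ch Ct s))"
proof -
  have inner: "measure_pmf.expectation (\<pi> h s \<bind> (\<lambda>a. return_pmf (s, a))) (\<lambda>(s, a). cost Ch Ct s a)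
      = measure_pmf.expectation (\<pi> h s) (cost Ch Ct s)" for h s
    by (subst expectation_bind_finite) auto
  show ?thesis
    unfolding exp_cost_def case_prod_beta
    by (subst expectation_bind_finite)
       (simp_all add: finite_set_traj inner[unfolded case_prod_beta])
qed

lemma exp_state_Suc:
  "exp_state p1 p2 \<pi> f (Suc n) = measure_pmf.expectation (traj p1 p2 \<pi> n)
     (\<lambda>(h, s). measure_pmf.expectation (\<pi> h s)
        (\<lambda>a. measure_pmf.expectation (trans p1 p2 s a) f))"
proof -
  have inner: "measure_pmf.expectation
        (\<pi> h s \<bind> (\<lambda>a. trans p1 p2 s a \<bind> (\<lambda>s'. return_pmf (h @ [(s, a)], s')))) (\<lambda>(h, s). f s)
      = measure_pmf.expectation (\<pi> h s) (\<lambda>a. measure_pmf.expectation (trans p1 p2 s a) f)" for h s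
    by (simp add: expectation_bind_finite finite_set_trans)
  show ?thesis
    unfolding exp_state_def traj.simps case_prod_beta
    by (subst expectation_bind_finite)
       (simp_all add: finite_set_traj finite_set_trans inner[unfolded case_prod_beta])
qed

lemma exp_cost_plus_exp_state:
  "exp_cost p1 p2 Ch Ct \<pi> n + exp_state p1 p2 \<pi> f (Suc n) =
   measure_pmf.expectation (traj p1 p2 \<pi> n) (\<lambda>(h, s). measure_pmf.expectation (\<pi> h s)
     (\<lambda>a. cost Ch Ct s a + measure_pmf.expectation (trans p1 p2 s a) f))"
  unfolding exp_cost_alt exp_state_Suc case_prod_beta
  by (simp add: integrable_measure_pmf_finite finite_set_traj)

text \<open>Both kernels become one: since \<open>max i 1 = (i - 1) + 1\<close> in truncated
  subtraction, arrivals are simply added to the post-decision state.\<close>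

lemma expectation_trans:
  fixes f :: "state \<Rightarrow> real"
  assumes "0 \<le> p1" "p1 \<le> 1" "0 \<le> p2" "p2 \<le> 1"
  shows "measure_pmf.expectation (trans p1 p2 s a) f =
    (let i = fst s - of_bool a; j = snd s - of_bool a in
     (1 - p1) * (1 - p2) * f (i, j) + p1 * (1 - p2) * f (i + 1, j)
     + (1 - p1) * p2 * f (i, j + 1) + p1 * p2 * f (i + 1, j + 1))"
  using assms
  by (auto simp: trans_def Let_def expectation_bind_finite algebra_simps max_def
      intro!: arg_cong[where f = f] split: if_splits)

section \<open>Long-run averages from one-step relations\<close>

lemma limsup_average_le:
  fixes c F :: "nat \<Rightarrow> real"
  assumes step: "\<And>n. c n + F (Suc n) = g + F n" and F: "F 0 = 0" "\<And>n. - B \<le> F n"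
  shows "limsup (\<lambda>N. ereal ((\<Sum>n\<le>N. c n) / real (N + 1))) \<le> ereal g"
proof -
  have sum: "(\<Sum>n\<le>N. c n) = real (N + 1) * g - F (Suc N)" for N
  proof (induction N)
    case 0
    then show ?case using step[of 0] F by simp
  next
    case (Suc N)
    then show ?case using step[of "Suc N"] by (simp add: algebra_simps)
  qed
  have "(\<Sum>n\<le>N. c n) / real (N + 1) \<le> g + B / real (N + 1)" for N
  proof -
    have "(\<Sum>n\<le>N. c n) \<le> real (N + 1) * g + B"
      using F(2)[of "Suc N"] sum[of N] by simp
    then have "(\<Sum>n\<le>N. c n) / real (N + 1) \<le> (real (N + 1) * g + B) / real (N + 1)"
      by (intro divide_right_mono) auto
    then show ?thesis by (simp add: add_divide_distrib)
  qed
  then have "limsup (\<lambda>N. ereal ((\<Sum>n\<le>N. c n) / real (N + 1)))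
      \<le> limsup (\<lambda>N. ereal (g + B / real (N + 1)))"
    by (intro Limsup_mono always_eventually) auto
  also have "(\<lambda>N. g + B / real (N + 1)) \<longlonglongrightarrow> g + 0"
    by (intro tendsto_add tendsto_const LIMSEQ_ignore_initial_segment[of "\<lambda>n. B / real n" 0 1] lim_const_over_n)
  then have "limsup (\<lambda>N. ereal (g + B / real (N + 1))) = ereal g"
    by (intro lim_imp_Limsup) auto
  finally show ?thesis .
qed

text \<open>The potential \<open>F n\<close> need not be \<open>o(n)\<close>. But if the averages stay below \<open>g - \<epsilon>\<close>, then
  \<open>F n \<ge> \<epsilon> n\<close> eventually, and as \<open>F\<close> is dominated by \<open>c\<close> this makes \<open>c\<close> exceed \<open>g\<close> eventually.\<close>

lemma limsup_average_ge:
  fixes c F :: "nat \<Rightarrow> real"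
  assumes step: "\<And>n. g + F n \<le> c n + F (Suc n)" and F: "F 0 = 0"
    and dom: "\<And>n. F n \<le> K * c n + B" and K: "0 < K" and c: "\<And>n. 0 \<le> c n"
  shows "ereal g \<le> limsup (\<lambda>N. ereal ((\<Sum>n\<le>N. c n) / real (N + 1)))"
proof (rule ccontr)
  assume "\<not> ?thesis"
  then have "limsup (\<lambda>N. ereal ((\<Sum>n\<le>N. c n) / real (N + 1))) < ereal g"
    by (simp only: not_le)
  from ereal_dense2[OF this]
  obtain r where r: "limsup (\<lambda>N. ereal ((\<Sum>n\<le>N. c n) / real (N + 1))) < ereal r" "r < g"
    by auto
  have "\<forall>\<^sub>F N in sequentially. (\<Sum>n\<le>N. c n) / real (N + 1) < r"
    using Limsup_lessD[OF r(1)] by simp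
  then obtain N0 where N0: "\<And>N. N0 \<le> N \<Longrightarrow> (\<Sum>n\<le>N. c n) < r * real (N + 1)"
    by (auto simp: eventually_sequentially pos_divide_less_eq)
  have sum: "real (N + 1) * g - F (Suc N) \<le> (\<Sum>n\<le>N. c n)" for N
  proof (induction N)
    case 0
    then show ?case using step[of 0] F by simp
  next
    case (Suc N)
    then show ?case using step[of "Suc N"] by (simp add: algebra_simps)
  qed
  \<comment> \<open>From \<open>N1\<close> on, \<open>(g - r) * (N + 1)\<close> exceeds
    \<open>K * g + B\<close>, so the domination of \<open>F\<close> by \<open>c\<close> forces
    \<open>c \<ge> g\<close>.\<close>
  obtain N1 :: nat where N1: "(K * g + B) / (g - r) < real N1"
    using reals_Archimedean2 by blast
  define N2 where "N2 = N0 + N1"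
  have large: "g \<le> c (Suc N)" if "N2 \<le> N" for N
  proof -
    have "(g - r) * real (N + 1) \<le> F (Suc N)"
      using sum[of N] N0[of N] that by (simp add: N2_def algebra_simps)
    moreover have "(K * g + B) / (g - r) \<le> real (N + 1)"
      using N1 that by (simp add: N2_def)
    then have "K * g + B \<le> (g - r) * real (N + 1)"
      using r by (simp add: pos_divide_le_eq mult.commute)
    ultimately have "K * g \<le> K * c (Suc N)" using dom[of "Suc N"] by linarith
    then show ?thesis using K by simp
  qed
  \<comment> \<open>The terms up to \<open>N2\<close> are dropped as nonnegative; each of the other
    \<open>k\<close> is at least \<open>g\<close>. Growth at rate \<open>g\<close> contradicts
    averages below \<open>r\<close>.\<close>
  have grow: "real k * g \<le> (\<Sum>n\<le>N2 + k. c n)" for k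
  proof (induction k)
    case 0
    then show ?case by (simp add: sum_nonneg c)
  next
    case (Suc k)
    then show ?case using large[of "N2 + k"] by (simp add: algebra_simps)
  qed
  obtain k :: nat where k: "r * real (N2 + 1) / (g - r) < real k"
    using reals_Archimedean2 by blast
  then have "r * real (N2 + 1) < real k * (g - r)"
    using r by (simp add: pos_divide_less_eq)
  moreover have "real k * g < r * real (N2 + k + 1)"
    using grow[of k] N0[of "N2 + k"] by (simp add: N2_def)
  ultimately show False by (simp add: algebra_simps)
qed

section \<open>Verification\<close>

text \<open>Interface between the slope recursion and the verification: the \<open>_le\<close> and
  \<open>_sub\<close> facts give the lower bound for all policies, the \<open>_sol\<close> and
  \<open>_above\<close> facts turn it into equality along the threshold policy.\<close>

locale relay_bellman =
  fixes p1 p2 Ch Ct g :: real and D1 D2 :: "nat \<Rightarrow> real" and L1 L2 :: nat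
  assumes p1: "0 < p1" "p1 < 1" and p2: "0 < p2" "p2 < 1" and Ct: "0 < Ct" and Ch: "0 < Ch"
    and D1_le: "D1 z \<le> Ct"
    and D1_sub: "g \<le> Ch * real z + p2 * Ct + p1 * (1 - p2) * D1 (Suc z) - (1 - p1) * p2 * D1 z"
    and D1_sol: "z \<le> L1 \<Longrightarrow>
      g = Ch * real z + p2 * Ct + p1 * (1 - p2) * D1 (Suc z) - (1 - p1) * p2 * D1 z"
    and D1_above: "L1 < z \<Longrightarrow> D1 z = Ct"
    and D2_le: "D2 z \<le> Ct"
    and D2_sub: "g \<le> Ch * real z + p1 * Ct + p2 * (1 - p1) * D2 (Suc z) - (1 - p2) * p1 * D2 z"
    and D2_sol: "z \<le> L2 \<Longrightarrow>
      g = Ch * real z + p1 * Ct + p2 * (1 - p1) * D2 (Suc z) - (1 - p2) * p1 * D2 z"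
    and D2_above: "L2 < z \<Longrightarrow> D2 z = Ct"
    and gain: "g = p1 * p2 * Ct + p1 * (1 - p2) * D1 1 + (1 - p1) * p2 * D2 1"
begin

section \<open>The bias function and its optimality inequality\<close>

definition w1 :: "nat \<Rightarrow> real" where "w1 n = (\<Sum>k<n. D1 (Suc k))"
definition w2 :: "nat \<Rightarrow> real" where "w2 n = (\<Sum>k<n. D2 (Suc k))"

lemma w_simps [simp]:
  "w1 0 = 0" "w1 (Suc n) = w1 n + D1 (Suc n)" "w2 0 = 0" "w2 (Suc n) = w2 n + D2 (Suc n)"
  by (simp_all add: w1_def w2_def)

lemma w_le: "w1 n \<le> Ct * real n" "w2 n \<le> Ct * real n"
proof -
  show "w1 n \<le> Ct * real n"
    by (induction n) (auto simp: distrib_left add.commute[of Ct] intro!: add_mono D1_le)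
  show "w2 n \<le> Ct * real n"
    by (induction n) (auto simp: distrib_left add.commute[of Ct] intro!: add_mono D2_le)
qed

text \<open>With both queues nonempty the coded transmission is forced: it costs \<open>Ct\<close>
  and removes one packet from each.\<close>

definition bias :: "state \<Rightarrow> real" where
  "bias s = (case s of (i, j) \<Rightarrow>
     if i = 0 \<or> j = 0 then w1 i + w2 j else Ct + w1 (i - 1) + w2 (j - 1))"

definition exp_bias :: "nat \<Rightarrow> nat \<Rightarrow> real" where
  "exp_bias i j = (1 - p1) * (1 - p2) * bias (i, j) + p1 * (1 - p2) * bias (i + 1, j)
     + (1 - p1) * p2 * bias (i, j + 1) + p1 * p2 * bias (i + 1, j + 1)"

lemma post_decision_cases:
  assumes "min i j = (0::nat)"
  obtains "i = 0" "j = 0" | z where "i = Suc z" "j = 0" | z where "i = 0" "j = Suc z"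
  using assms by (cases i; cases j) auto

lemma exp_bias_origin: "exp_bias 0 0 = g"
  by (subst gain) (simp add: exp_bias_def bias_def)

text \<open>An arrival to the empty queue always triggers a coded transmission, hence
  \<open>p2 * Ct\<close>. The occupied queue then gains a slope if only it receives a packet, loses
  one if only the other does, and is otherwise unchanged.\<close>

lemma exp_bias_axis1:
  "exp_bias (Suc z) 0 = w1 (Suc z) + p2 * Ct + p1 * (1 - p2) * D1 (Suc (Suc z))
     - (1 - p1) * p2 * D1 (Suc z)"
  by (simp add: exp_bias_def bias_def) (simp add: algebra_simps)

lemma exp_bias_axis2:
  "exp_bias 0 (Suc z) = w2 (Suc z) + p1 * Ct + p2 * (1 - p1) * D2 (Suc (Suc z))
     - (1 - p2) * p1 * D2 (Suc z)"
  by (simp add: exp_bias_def bias_def) (simp add: algebra_simps)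

lemma post_decision_sub:
  assumes "min i j = 0"
  shows "g + w1 i + w2 j \<le> Ch * real (i + j) + exp_bias i j"
  using assms
proof (cases rule: post_decision_cases)
  case 1
  then show ?thesis by (simp add: exp_bias_origin)
next
  case (2 z)
  then show ?thesis using D1_sub[of "Suc z"] by (simp add: exp_bias_axis1)
next
  case (3 z)
  then show ?thesis using D2_sub[of "Suc z"] by (simp add: exp_bias_axis2)
qed

lemma post_decision_sol:
  assumes "min i j = 0" "i \<le> L1" "j \<le> L2"
  shows "g + w1 i + w2 j = Ch * real (i + j) + exp_bias i j"
  using assms(1)
proof (cases rule: post_decision_cases)
  case 1
  then show ?thesis by (simp add: exp_bias_origin)
next
  case (2 z)
  then show ?thesis using D1_sol[of "Suc z"] assms by (simp add: exp_bias_axis1)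
next
  case (3 z)
  then show ?thesis using D2_sol[of "Suc z"] assms by (simp add: exp_bias_axis2)
qed

lemma expectation_trans_bias:
  "measure_pmf.expectation (trans p1 p2 s a) bias = exp_bias (fst s - of_bool a) (snd s - of_bool a)"
  using p1 p2 by (subst expectation_trans) (auto simp: exp_bias_def Let_def)

definition reachable :: "state \<Rightarrow> bool" where
  "reachable s \<longleftrightarrow> min (fst s) (snd s) \<le> 1"

definition allowed :: "state \<Rightarrow> bool \<Rightarrow> bool" where
  "allowed s a \<longleftrightarrow> (fst s + snd s = 0 \<longrightarrow> \<not> a) \<and> (0 < fst s * snd s \<longrightarrow> a)"

lemma post_on_axis:
  assumes "reachable s" "allowed s a"
  shows "min (fst s - of_bool a) (snd s - of_bool a) = 0"
  using assms by (cases a) (auto simp: reachable_def allowed_def)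

text \<open>Equality holds except for an uncoded transmission, where the claim is that a slope is at
  most \<open>Ct\<close>. This is what the truncation is for.\<close>

lemma bias_le_post:
  assumes "reachable s" "allowed s a"
  shows "bias s \<le> Ct * of_bool a + w1 (fst s - of_bool a) + w2 (snd s - of_bool a)"
proof (cases s)
  case (Pair i j)
  then show ?thesis
    using assms D1_le[of i] D2_le[of j]
    by (cases i; cases j; cases a) (simp_all add: bias_def reachable_def allowed_def)
qed

lemma bellman_sub:
  assumes "reachable s" "allowed s a"
  shows "g + bias s \<le> cost Ch Ct s a + measure_pmf.expectation (trans p1 p2 s a) bias"
  using bias_le_post[OF assms] post_decision_sub[OF post_on_axis[OF assms]]
  by (simp add: expectation_trans_bias cost_def)

section \<open>Lower bound for every admissible policy\<close>

lemma admissible_allowed: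
  assumes "admissible \<pi>" "a \<in> set_pmf (\<pi> h s)"
  shows "allowed s a"
proof (cases s)
  case (Pair i j)
  have "i + j = 0 \<longrightarrow> \<pi> h (i, j) = return_pmf False"
    "0 < i * j \<longrightarrow> \<pi> h (i, j) = return_pmf True"
    using assms(1) unfolding admissible_def by blast+
  with assms(2) Pair show ?thesis
    by (cases i; cases j) (simp_all add: allowed_def)
qed

lemma set_trans_bounds:
  assumes "s' \<in> set_pmf (trans p1 p2 s a)"
  shows "fst s' \<le> Suc (fst s - of_bool a)" "snd s' \<le> Suc (snd s - of_bool a)"
proof -
  obtain x y where s': "s' = (if a then (if x then max (fst s) 1 else fst s - 1,
                            if y then max (snd s) 1 else snd s - 1)
                 else (fst s + (if x then 1 else 0), snd s + (if y then 1 else 0)))"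
    using assms unfolding trans_def set_bind_pmf set_return_pmf by blast
  show "fst s' \<le> Suc (fst s - of_bool a)" "snd s' \<le> Suc (snd s - of_bool a)"
    unfolding s' by (cases a; cases x; cases y; simp)+
qed

lemma traj_reachable:
  assumes "admissible \<pi>" "(h, s) \<in> set_pmf (traj p1 p2 \<pi> n)"
  shows "reachable s"
  using assms(2)
proof (induction n arbitrary: h s)
  case 0
  then show ?case by (simp add: reachable_def)
next
  case (Suc n)
  then obtain h' s' a where *: "(h', s') \<in> set_pmf (traj p1 p2 \<pi> n)" "a \<in> set_pmf (\<pi> h' s')"
    "s \<in> set_pmf (trans p1 p2 s' a)"
    by auto
  have "min (fst s' - of_bool a) (snd s' - of_bool a) = 0"
    by (rule post_on_axis[OF Suc.IH[OF *(1)] admissible_allowed[OF assms(1) *(2)]])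
  then show ?case using set_trans_bounds[OF *(3)] unfolding reachable_def by linarith
qed

lemma exp_state_step:
  assumes "admissible \<pi>"
  shows "g + exp_state p1 p2 \<pi> bias n \<le> exp_cost p1 p2 Ch Ct \<pi> n + exp_state p1 p2 \<pi> bias (Suc n)"
proof -
  have "g + exp_state p1 p2 \<pi> bias n =
      measure_pmf.expectation (traj p1 p2 \<pi> n) (\<lambda>(h, s). measure_pmf.expectation (\<pi> h s) (\<lambda>a. g + bias s))"
    unfolding exp_state_def case_prod_beta
    by (simp add: integrable_measure_pmf_finite finite_set_traj)
  also have "\<dots> \<le> exp_cost p1 p2 Ch Ct \<pi> n + exp_state p1 p2 \<pi> bias (Suc n)"
    unfolding exp_cost_plus_exp_state
  proof (rule expectation_mono_finite[OF finite_set_traj], clarify)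
    fix h i j assume *: "(h, (i, j)) \<in> set_pmf (traj p1 p2 \<pi> n)"
    show "measure_pmf.expectation (\<pi> h (i, j)) (\<lambda>a. g + bias (i, j)) \<le>
        measure_pmf.expectation (\<pi> h (i, j))
          (\<lambda>a. cost Ch Ct (i, j) a + measure_pmf.expectation (trans p1 p2 (i, j) a) bias)"
      using traj_reachable[OF assms *] admissible_allowed[OF assms]
      by (intro expectation_mono_finite bellman_sub) auto
  qed
  finally show ?thesis .
qed

lemma cost_nonneg: "0 \<le> cost Ch Ct s a"
  using Ch Ct by (simp add: cost_def)

text \<open>Each packet contributes at most \<open>Ct\<close> to the bias and \<open>Ch\<close> to
  the holding cost. The constant 3 counts the two packets a transmission may remove and the extra
  \<open>Ct\<close> in the bias when both queues are occupied.\<close>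

lemma bias_le_cost: "bias s \<le> Ct / Ch * cost Ch Ct s a + 3 * Ct"
proof -
  obtain i j where s: "s = (i, j)" by (cases s)
  have "bias s \<le> Ct + Ct * real (i + j)"
  proof (cases "i = 0 \<or> j = 0")
    case True
    then show ?thesis using w_le(1)[of i] w_le(2)[of j] Ct by (simp add: s bias_def distrib_left)
  next
    case False
    then have "w1 (i - 1) \<le> Ct * real i" "w2 (j - 1) \<le> Ct * real j"
      using w_le(1)[of "i - 1"] w_le(2)[of "j - 1"] Ct
      by (auto intro: order_trans mult_left_mono)
    then show ?thesis using False by (simp add: s bias_def distrib_left)
  qed
  also have "\<dots> \<le> Ct * (real (i - of_bool a + (j - of_bool a)) + 3)"
  proof -
    have "real i + real j \<le> real (i - of_bool a) + real (j - of_bool a) + 2"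
      by (cases i; cases j; cases a) auto
    then have "Ct * (real i + real j) \<le> Ct * (real (i - of_bool a) + real (j - of_bool a) + 2)"
      using Ct by (intro mult_left_mono) auto
    then show ?thesis by (simp add: algebra_simps)
  qed
  also have "\<dots> = Ct / Ch * (Ch * real (i - of_bool a + (j - of_bool a))) + 3 * Ct"
    using Ch by (simp add: field_simps)
  also have "\<dots> \<le> Ct / Ch * cost Ch Ct s a + 3 * Ct"
    using Ct Ch by (intro add_right_mono mult_left_mono) (auto simp: s cost_def)
  finally show ?thesis .
qed

lemma exp_state_le_exp_cost:
  "exp_state p1 p2 \<pi> bias n \<le> Ct / Ch * exp_cost p1 p2 Ch Ct \<pi> n + 3 * Ct"
proof -
  have "bias s \<le> Ct / Ch * measure_pmf.expectation (\<pi> h s) (cost Ch Ct s) + 3 * Ct" for h s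
  proof -
    have "bias s = measure_pmf.expectation (\<pi> h s) (\<lambda>a. bias s)" by simp
    also have "\<dots> \<le> measure_pmf.expectation (\<pi> h s) (\<lambda>a. Ct / Ch * cost Ch Ct s a + 3 * Ct)"
      by (intro expectation_mono_finite bias_le_cost) auto
    also have "\<dots> = Ct / Ch * measure_pmf.expectation (\<pi> h s) (cost Ch Ct s) + 3 * Ct"
      by (simp add: integrable_measure_pmf_finite)
    finally show ?thesis .
  qed
  then have "exp_state p1 p2 \<pi> bias n \<le> measure_pmf.expectation (traj p1 p2 \<pi> n)
      (\<lambda>(h, s). Ct / Ch * measure_pmf.expectation (\<pi> h s) (cost Ch Ct s) + 3 * Ct)"
    unfolding exp_state_def by (intro expectation_mono_finite finite_set_traj) auto
  also have "\<dots> = Ct / Ch * exp_cost p1 p2 Ch Ct \<pi> n + 3 * Ct"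
    unfolding exp_cost_alt case_prod_beta
    by (simp add: integrable_measure_pmf_finite finite_set_traj)
  finally show ?thesis .
qed

lemma gain_le_avg_cost:
  assumes "admissible \<pi>"
  shows "ereal g \<le> avg_cost p1 p2 Ch Ct \<pi>"
  unfolding avg_cost_def
proof (rule limsup_average_ge)
  show "g + exp_state p1 p2 \<pi> bias n \<le> exp_cost p1 p2 Ch Ct \<pi> n + exp_state p1 p2 \<pi> bias (Suc n)" for n
    by (rule exp_state_step[OF assms])
  show "exp_state p1 p2 \<pi> bias 0 = 0" by (simp add: exp_state_0 bias_def)
  show "exp_state p1 p2 \<pi> bias n \<le> Ct / Ch * exp_cost p1 p2 Ch Ct \<pi> n + 3 * Ct" for n
    by (rule exp_state_le_exp_cost)
  show "0 < Ct / Ch" using Ct Ch by simp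
  show "0 \<le> exp_cost p1 p2 Ch Ct \<pi> n" for n
    unfolding exp_cost_alt by (intro integral_nonneg_AE AE_pmfI) (auto simp: cost_nonneg)
qed

section \<open>The threshold policy attains the gain\<close>

lemma admissible_thr_policy: "admissible (thr_policy L1 L2)"
  by (auto simp: admissible_def thr_policy_def thr_action_def)

lemma thr_action_allowed: "allowed s (thr_action L1 L2 s)"
  by (auto simp: allowed_def thr_action_def)

text \<open>After a decision at most \<open>L1\<close> and \<open>L2\<close> packets remain, and one
  slot adds at most one to each queue. This box keeps post-decision states where the recursion holds
  with equality.\<close>

definition thr_reachable :: "state \<Rightarrow> bool" where
  "thr_reachable s \<longleftrightarrow> reachable s \<and> fst s \<le> Suc L1 \<and> snd s \<le> Suc L2"

lemma thr_post_bounded: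
  assumes "thr_reachable s"
  shows "fst s - of_bool (thr_action L1 L2 s) \<le> L1" "snd s - of_bool (thr_action L1 L2 s) \<le> L2"
  using assms by (auto simp: thr_reachable_def thr_action_def)

text \<open>Uncoded transmission happens only above the threshold, where the slope equals
  \<open>Ct\<close>.\<close>

lemma bias_eq_post:
  "bias s = Ct * of_bool (thr_action L1 L2 s) + w1 (fst s - of_bool (thr_action L1 L2 s))
     + w2 (snd s - of_bool (thr_action L1 L2 s))"
proof (cases s)
  case (Pair i j)
  then show ?thesis
    using D1_above[of i] D2_above[of j] by (cases i; cases j) (simp_all add: bias_def thr_action_def)
qed

lemma bellman_sol:
  assumes "thr_reachable s"
  shows "cost Ch Ct s (thr_action L1 L2 s)
      + measure_pmf.expectation (trans p1 p2 s (thr_action L1 L2 s)) bias = g + bias s"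
proof -
  have "reachable s" using assms by (simp add: thr_reachable_def)
  then show ?thesis
    using bias_eq_post[of s]
      post_decision_sol[OF post_on_axis[OF _ thr_action_allowed] thr_post_bounded[OF assms]]
    by (simp add: expectation_trans_bias cost_def)
qed

lemma traj_thr_reachable:
  assumes "(h, s) \<in> set_pmf (traj p1 p2 (thr_policy L1 L2) n)"
  shows "thr_reachable s"
  using assms
proof (induction n arbitrary: h s)
  case 0
  then show ?case by (simp add: thr_reachable_def reachable_def)
next
  case (Suc n)
  then obtain h' s' a where "(h', s') \<in> set_pmf (traj p1 p2 (thr_policy L1 L2) n)"
    "a \<in> set_pmf (thr_policy L1 L2 h' s')" "s \<in> set_pmf (trans p1 p2 s' a)"
    by auto
  then have *: "(h', s') \<in> set_pmf (traj p1 p2 (thr_policy L1 L2) n)"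
    "s \<in> set_pmf (trans p1 p2 s' (thr_action L1 L2 s'))"
    by (auto simp: thr_policy_def)
  have "fst s \<le> Suc L1" "snd s \<le> Suc L2"
    using set_trans_bounds[OF *(2)] thr_post_bounded[OF Suc.IH[OF *(1)]] by auto
  then show ?case
    using traj_reachable[OF admissible_thr_policy Suc.prems] by (simp add: thr_reachable_def)
qed

lemma avg_cost_thr_policy_le: "avg_cost p1 p2 Ch Ct (thr_policy L1 L2) \<le> ereal g"
proof -
  let ?\<pi> = "thr_policy L1 L2"
  define R where "R = {..Suc L1} \<times> {..Suc L2}"
  \<comment> \<open>The trajectory stays in the finite box \<open>R\<close>, so its minimal bias
    serves as the lower bound on the potential.\<close>
  have lower: "Min (bias ` R) \<le> bias s" if "(h, s) \<in> set_pmf (traj p1 p2 ?\<pi> n)" for h s n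
  proof -
    have "s \<in> R" using traj_thr_reachable[OF that] by (cases s) (auto simp: thr_reachable_def R_def)
    then show ?thesis by (intro Min_le) (auto simp: R_def)
  qed
  show ?thesis
    unfolding avg_cost_def
  proof (rule limsup_average_le)
    fix n
    show "exp_cost p1 p2 Ch Ct ?\<pi> n + exp_state p1 p2 ?\<pi> bias (Suc n) = g + exp_state p1 p2 ?\<pi> bias n"
    proof -
      have "exp_cost p1 p2 Ch Ct ?\<pi> n + exp_state p1 p2 ?\<pi> bias (Suc n) =
          measure_pmf.expectation (traj p1 p2 ?\<pi> n) (\<lambda>(h, s). g + bias s)"
        unfolding exp_cost_plus_exp_state
        by (rule expectation_cong_pmf)
           (auto simp: thr_policy_def dest!: traj_thr_reachable intro!: bellman_sol)
      also have "\<dots> = g + exp_state p1 p2 ?\<pi> bias n"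
        unfolding exp_state_def case_prod_beta
        by (simp add: integrable_measure_pmf_finite finite_set_traj)
      finally show ?thesis .
    qed
    have "measure_pmf.expectation (traj p1 p2 ?\<pi> n) (\<lambda>_. Min (bias ` R)) \<le> exp_state p1 p2 ?\<pi> bias n"
      unfolding exp_state_def
      by (rule expectation_mono_finite[OF finite_set_traj]) (auto intro: lower)
    then show "- (- Min (bias ` R)) \<le> exp_state p1 p2 ?\<pi> bias n" by simp
  qed (simp add: exp_state_0 bias_def)
qed

end

theorem theorem3:
  fixes p1 p2 Ch Ct :: real
  assumes "0 < p1" "p1 < 1" "0 < p2" "p2 < 1" "0 < Ct" "0 < Ch"
  shows "\<exists>L1 L2 :: nat. admissible (thr_policy L1 L2) \<and>
           (\<forall>\<pi>. admissible \<pi> \<longrightarrow>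
              avg_cost p1 p2 Ch Ct (thr_policy L1 L2) \<le> avg_cost p1 p2 Ch Ct \<pi>)"
proof -
  obtain g where g: "p1 * Ct \<le> g" "p2 * Ct \<le> g" "g \<le> Ct"
    and gain: "g = p1 * p2 * Ct + p1 * (1 - p2) * gap p1 p2 Ch Ct g 1
                 + (1 - p1) * p2 * gap p2 p1 Ch Ct g 1"
    by (rule optimal_gain_exists[OF assms])
  obtain L1 where L1:
    "\<And>z. z \<le> L1 \<Longrightarrow> g = Ch * real z + p2 * Ct + p1 * (1 - p2) * gap p1 p2 Ch Ct g (Suc z)
                        - (1 - p1) * p2 * gap p1 p2 Ch Ct g z"
    "\<And>z. L1 < z \<Longrightarrow> gap p1 p2 Ch Ct g z = Ct"
    using gap_threshold[OF assms g(1,3)] by blast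
  \<comment> \<open>The second axis is the first with the arrival probabilities exchanged.\<close>
  obtain L2 where L2:
    "\<And>z. z \<le> L2 \<Longrightarrow> g = Ch * real z + p1 * Ct + p2 * (1 - p1) * gap p2 p1 Ch Ct g (Suc z)
                        - (1 - p2) * p1 * gap p2 p1 Ch Ct g z"
    "\<And>z. L2 < z \<Longrightarrow> gap p2 p1 Ch Ct g z = Ct"
    using gap_threshold[OF assms(3,4,1,2,5,6) g(2,3)] by blast
  interpret relay_bellman p1 p2 Ch Ct g "gap p1 p2 Ch Ct g" "gap p2 p1 Ch Ct g" L1 L2
  proof
    fix z
    show "g \<le> Ch * real z + p2 * Ct + p1 * (1 - p2) * gap p1 p2 Ch Ct g (Suc z)
            - (1 - p1) * p2 * gap p1 p2 Ch Ct g z"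
      by (intro gap_subsolution assms g)
    show "g \<le> Ch * real z + p1 * Ct + p2 * (1 - p1) * gap p2 p1 Ch Ct g (Suc z)
            - (1 - p2) * p1 * gap p2 p1 Ch Ct g z"
      by (intro gap_subsolution assms g)
  qed (fact assms gap_le L1 L2 gain)+
  show ?thesis
    using admissible_thr_policy order_trans[OF avg_cost_thr_policy_le gain_le_avg_cost]
    by (intro exI[of _ L1] exI[of _ L2]) simp
qed

end
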